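(* Let $G$ be a digraph consisting of two cycles that have exactly $m\ge 1$ common edges. If the shorter cycle is of length greater than $m+2$, then for each of the two cycles $C$ of $G$ there is a complete realisation of $G\subset G'$ (for a suitable $G'$ obtained from $G$ by adding edges between existing vertices) such that $C$ has exactly $m+1$ positive transverse eigenvalues, namely one at each of the equilibria common to both cycles.
   Context: Digraphs. All digraphs $G=(V,A)$ are finite, with at most one edge $[v_j\to v_i]$ for each ordered pair of vertices. A digraph consists of two cycles if it is the connected union of two different directed cycles and contains no other cycles. Then the common edges form a single uninterrupted directed path, so that for $m\ge1$ common edges there are $m+1$ common vertices. If the cycle lengths (numbers of vertices) $k,\ell$ satisfy $k\le\ell$, the $k$-cycle is called the shorter and the $\ell$-cycle the longer cycle. Simplex method. Let $G'=(V,A')$ be a strongly connected digraph on $V=\{v_1,\dots,v_n\}$ without 1-cycles and 2-cycles. The simplex method associates with $G'$ the system on $\mathbb{R}^n$ $$\dot x_i = x_i\Big(1-|x|^2+\sum_{j=1}^n a_{ji}x_j^2\Big),\quad i=1,\dots,n,$$ with $a_{ii}=0$, and for $i\ne j$: $a_{ji}>0$ if $[v_j\to v_i]\in A'$ and $a_{ji}<0$ otherwise. The vertex $v_j$ corresponds to the equilibrium $\xi_j$, the unit vector on the positive $x_j$-axis; the eigenvalue of the linearisation at $\xi_j$ in the direction of $x_i$ ($i\neq j$) is $a_{ji}$ and the radial eigenvalue is $-2$. For each edge $[v_j\to v_i]\in A'$ there is a heteroclinic connection $[\xi_j\to\xi_i]$ (a non-empty intersection $W^u(\xi_j)\cap W^s(\xi_i)$)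 containing a trajectory in the $(x_j,x_i)$-coordinate plane. The system is equivariant under $\mathbb{Z}_2^n$ acting by reflections in the coordinate hyperplanes, and equilibria and connections are understood up to this symmetry (equivalently, one works in the closed orthant $x_i\ge 0$). The heteroclinic network $X$ realising $G'$ consists of the equilibria $\xi_j$ and the full sets of connections $W^u(\xi_j)\cap W^s(\xi_i)$. Completeness. A heteroclinic network is complete if it contains the unstable manifolds of all its equilibria, i.e. every trajectory in every $W^u(\xi_j)$ converges in forward time to one of the equilibria of the network. Complete realisation. For a strongly connected digraph $G=(V,A)$ without 1- and 2-cycles and a digraph $G'=(V,A')$ with the same vertex set, $A\subset A'$, and without 1- and 2-cycles, $G\subset G'$ has a complete realisation if the simplex method applied to $G'$ (with suitable coefficients of the prescribed signs) produces a complete heteroclinic network $X$; then $X$ is called a complete realisation of $G\subset G'$. Transverse eigenvalues. Let $C$ be a cycle of $G$, viewed as a heteroclinic cycle in $X$ using the connecting trajectories in coordinate planes. At an equilibrium $\xi_j$ of $C$, with predecessor $\xi_p$ and successor $\xi_s$ in $C$, the eigenvalue in direction $x_j$ is radial, in direction $x_p$ contracting, in direction $x_s$ expanding, and the eigenvalues $a_{ji}$ in all remaining directions $x_i$, $i\notin\{j,p,s\}$, are the transverse eigenvalues of $C$ at $\xi_j$. *)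

theory Defs
  imports "HOL-Analysis.Analysis" "Graph_Theory.Graph_Theory"
begin

text \<open>
  The vertices are the elements of a finite type, so that a digraph on
  \<open>v\<^sub>1, \<dots>, v\<^sub>n\<close> has vertex set \<open>UNIV :: 'n set\<close> and the phase space is \<open>real ^ 'n\<close>.
  A cycle is a closed walk, given as a list of arcs; its rotations describe the same directed
  cycle, so cycles are compared by their arc sets.  The length of the list is the number of
  vertices of the cycle.
\<close>

definition cycle_verts :: "('n \<times> 'n) list \<Rightarrow> 'n set" where
  "cycle_verts C = fst ` set C"

definition consists_of_two_cycles ::
    "'n pair_pre_digraph \<Rightarrow> ('n \<times> 'n) list \<Rightarrow> ('n \<times> 'n) list \<Rightarrow> bool" where
  "consists_of_two_cycles G C D \<longleftrightarrow>
     pre_digraph.cycle (with_proj G) C \<and> pre_digraph.cycle (with_proj G) D \<and> set C \<noteq> set D \<and>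
     pverts G = cycle_verts C \<union> cycle_verts D \<and> parcs G = set C \<union> set D \<and>
     Digraph_Component.connected (with_proj G) \<and>
     (\<forall>E. pre_digraph.cycle (with_proj G) E \<longrightarrow> set E = set C \<or> set E = set D)"

definition no_1_2_cycles :: "'n pair_pre_digraph \<Rightarrow> bool" where
  "no_1_2_cycles G \<longleftrightarrow> (\<forall>E. pre_digraph.cycle (with_proj G) E \<longrightarrow> length E \<noteq> 1 \<and> length E \<noteq> 2)"

text \<open>
  Throughout, \<open>a j i\<close> is the coefficient \<open>a\<^sub>j\<^sub>i\<close>, attached to the arc from \<open>v\<^sub>j\<close> to \<open>v\<^sub>i\<close>.
\<close>

definition simplex_coefficients ::
    "'n pair_pre_digraph \<Rightarrow> ('n \<Rightarrow> 'n \<Rightarrow> real) \<Rightarrow> bool" where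
  "simplex_coefficients G a \<longleftrightarrow>
     (\<forall>i. a i i = 0) \<and>
     (\<forall>j i. i \<noteq> j \<longrightarrow> (if (j, i) \<in> parcs G then a j i > 0 else a j i < 0))"

definition simplex_field :: "('n::finite \<Rightarrow> 'n \<Rightarrow> real) \<Rightarrow> real ^ 'n \<Rightarrow> real ^ 'n" where
  "simplex_field a x = (\<chi> i. x $ i * (1 - (norm x)\<^sup>2 + (\<Sum>j\<in>UNIV. a j i * (x $ j)\<^sup>2)))"

definition equil :: "'n::finite \<Rightarrow> real ^ 'n" where
  "equil j = axis j 1"

text \<open>
  Equilibria and connections are taken modulo the reflections in the coordinate hyperplanes by
  restricting the dynamics to the closed positive orthant.
\<close>

definition orthant_solution ::
    "('n::finite \<Rightarrow> 'n \<Rightarrow> real) \<Rightarrow> real set \<Rightarrow> (real \<Rightarrow> real ^ 'n) \<Rightarrow> bool" where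
  "orthant_solution a T x \<longleftrightarrow>
     (\<forall>t\<in>T. (x has_vector_derivative simplex_field a (x t)) (at t within T)) \<and>
     (\<forall>t\<in>T. \<forall>i. 0 \<le> x t $ i)"

text \<open>
  The field need not be forward complete.  Points of an unstable manifold are only required to
  have a solution on \<open>(-\<infinity>, 0]\<close>; the inclusion of the unstable manifolds in the network demanded
  below then includes global existence and convergence in forward time.
\<close>

definition unstable_manifold ::
    "('n::finite \<Rightarrow> 'n \<Rightarrow> real) \<Rightarrow> real ^ 'n \<Rightarrow> (real ^ 'n) set" where
  "unstable_manifold a \<xi> = {x 0 | x. orthant_solution a {..0} x \<and> (x \<longlongrightarrow> \<xi>) at_bot}"

definition stable_manifold ::
    "('n::finite \<Rightarrow> 'n \<Rightarrow> real) \<Rightarrow> real ^ 'n \<Rightarrow> (real ^ 'n) set" where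
  "stable_manifold a \<xi> = {x 0 | x. orthant_solution a {0..} x \<and> (x \<longlongrightarrow> \<xi>) at_top}"

definition connection_set ::
    "('n::finite \<Rightarrow> 'n \<Rightarrow> real) \<Rightarrow> 'n \<Rightarrow> 'n \<Rightarrow> (real ^ 'n) set" where
  "connection_set a j i = unstable_manifold a (equil j) \<inter> stable_manifold a (equil i)"

definition planar_connection :: "('n::finite \<Rightarrow> 'n \<Rightarrow> real) \<Rightarrow> 'n \<Rightarrow> 'n \<Rightarrow> bool" where
  "planar_connection a j i \<longleftrightarrow>
     (\<exists>x. orthant_solution a UNIV x \<and> (\<forall>t k. k \<noteq> j \<longrightarrow> k \<noteq> i \<longrightarrow> x t $ k = 0) \<and>
          (x \<longlongrightarrow> equil j) at_bot \<and> (x \<longlongrightarrow> equil i) at_top)"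

definition network ::
    "'n::finite pair_pre_digraph \<Rightarrow> ('n \<Rightarrow> 'n \<Rightarrow> real) \<Rightarrow> (real ^ 'n) set" where
  "network G a = range equil \<union> (\<Union>(j, i)\<in>parcs G. connection_set a j i)"

definition complete_network ::
    "'n::finite pair_pre_digraph \<Rightarrow> ('n \<Rightarrow> 'n \<Rightarrow> real) \<Rightarrow> bool" where
  "complete_network G a \<longleftrightarrow> (\<forall>j. unstable_manifold a (equil j) \<subseteq> network G a)"

text \<open>
  \<open>spanning G G'\<close> says that \<open>G\<close> is a subgraph of \<open>G'\<close> with the same vertices.
  Strong connectedness of \<open>G'\<close> follows from that of \<open>G\<close>.
\<close>

definition complete_realisation ::
    "'n::finite pair_pre_digraph \<Rightarrow> 'n pair_pre_digraph \<Rightarrow> ('n \<Rightarrow> 'n \<Rightarrow> real) \<Rightarrow> bool" where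
  "complete_realisation G G' a \<longleftrightarrow>
     pverts G = UNIV \<and> strongly_connected (with_proj G) \<and> no_1_2_cycles G \<and>
     spanning (with_proj G) (with_proj G') \<and> no_1_2_cycles G' \<and>
     simplex_coefficients G' a \<and>
     (\<forall>(j, i)\<in>parcs G'. planar_connection a j i) \<and>
     complete_network G' a"

definition eigenvalue_in_direction ::
    "(real ^ 'n \<Rightarrow> real ^ 'n) \<Rightarrow> real ^ 'n \<Rightarrow> 'n::finite \<Rightarrow> real \<Rightarrow> bool" where
  "eigenvalue_in_direction F \<xi> i c \<longleftrightarrow>
     (\<exists>L. (F has_derivative L) (at \<xi>) \<and> L (axis i 1) = c *\<^sub>R axis i 1)"

lemma simplex_field_has_derivative:
  fixes x :: "real ^ 'n::finite"
  shows "(simplex_field a has_derivative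
     (\<lambda>h. \<chi> i. h $ i * (1 - (norm x)\<^sup>2 + (\<Sum>j\<in>UNIV. a j i * (x $ j)\<^sup>2)) +
              x $ i * ((\<Sum>j\<in>UNIV. a j i * (2 * x $ j * h $ j)) - 2 * (x \<bullet> h)))) (at x)"
proof -
  have eq: "simplex_field a =
      (\<lambda>x. \<chi> i. x $ i * (1 - x \<bullet> x + (\<Sum>j\<in>UNIV. a j i * (x $ j)\<^sup>2)))"
    by (simp add: simplex_field_def fun_eq_iff power2_norm_eq_inner)
  have nth: "((\<lambda>x. x $ i) has_derivative (\<lambda>h. h $ i)) (at x)" for i
    by (rule bounded_linear_imp_has_derivative[OF bounded_linear_vec_nth])
  have comp: "((\<lambda>x. x $ i * (1 - x \<bullet> x + (\<Sum>j\<in>UNIV. a j i * (x $ j)\<^sup>2))) has_derivative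
      (\<lambda>h. h $ i * (1 - x \<bullet> x + (\<Sum>j\<in>UNIV. a j i * (x $ j)\<^sup>2)) +
              x $ i * ((\<Sum>j\<in>UNIV. a j i * (2 * x $ j * h $ j)) - 2 * (x \<bullet> h)))) (at x)" for i
  proof -
    have "((\<lambda>x. a j i * (x $ j)\<^sup>2) has_derivative (\<lambda>h. a j i * (2 * x $ j * h $ j))) (at x)" for j
      unfolding power2_eq_square
      by (rule has_derivative_eq_rhs[OF has_derivative_mult_right[OF has_derivative_mult[OF nth nth]]])
         (simp add: fun_eq_iff)
    then have S: "((\<lambda>x. \<Sum>j\<in>UNIV. a j i * (x $ j)\<^sup>2) has_derivative
        (\<lambda>h. \<Sum>j\<in>UNIV. a j i * (2 * x $ j * h $ j))) (at x)"
      by (rule has_derivative_sum)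
    have N: "((\<lambda>x. x \<bullet> x) has_derivative (\<lambda>h. x \<bullet> h + h \<bullet> x)) (at x)"
      by (rule has_derivative_inner[OF has_derivative_ident has_derivative_ident])
    show ?thesis
      by (rule has_derivative_eq_rhs[OF has_derivative_mult[OF nth
            has_derivative_add[OF has_derivative_diff[OF has_derivative_const N] S]]])
         (simp add: fun_eq_iff inner_commute)
  qed
  show ?thesis
    unfolding eq power2_norm_eq_inner
  proof (rule iffD2[OF has_derivative_componentwise_within], rule ballI)
    fix b :: "real ^ 'n"
    assume "b \<in> Basis"
    then obtain i where b: "b = axis i 1"
      by (auto simp: Basis_vec_def)
    show "((\<lambda>x. (\<chi> i. x $ i * (1 - x \<bullet> x + (\<Sum>j\<in>UNIV. a j i * (x $ j)\<^sup>2))) \<bullet> b) has_derivative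
      (\<lambda>h. (\<chi> i. h $ i * (1 - x \<bullet> x + (\<Sum>j\<in>UNIV. a j i * (x $ j)\<^sup>2)) +
              x $ i * ((\<Sum>j\<in>UNIV. a j i * (2 * x $ j * h $ j)) - 2 * (x \<bullet> h))) \<bullet> b)) (at x)"
      unfolding b inner_axis vec_lambda_beta inner_real_def mult_1_right by (rule comp)
  qed
qed

lemma eigenvalue_in_direction_simplex_field:
  assumes "a j j = 0" and "i \<noteq> j"
  shows "eigenvalue_in_direction (simplex_field a) (equil j) i c \<longleftrightarrow> c = a j i"
proof -
  let ?L = "\<lambda>h. \<chi> i. h $ i * (1 - (norm (equil j))\<^sup>2 + (\<Sum>k\<in>UNIV. a k i * (equil j $ k)\<^sup>2)) +
      equil j $ i * ((\<Sum>k\<in>UNIV. a k i * (2 * equil j $ k * h $ k)) - 2 * (equil j \<bullet> h))"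
  have D: "(simplex_field a has_derivative ?L) (at (equil j))"
    by (rule simplex_field_has_derivative)
  have "a k i * (equil j $ k)\<^sup>2 = (if k = j then a k i else 0)" for k i
    by (simp add: equil_def axis_def)
  then have s: "(\<Sum>k\<in>UNIV. a k i * (equil j $ k)\<^sup>2) = a j i" for i
    by simp
  have z: "equil j $ k * axis i 1 $ k = 0" for k using assms by (auto simp: equil_def axis_def)
  have n: "norm (equil j) = 1" by (simp add: equil_def norm_axis_1)
  have o: "equil j \<bullet> axis i 1 = 0" using assms by (simp add: equil_def inner_axis_axis)
  have L: "?L (axis i 1) = a j i *\<^sub>R axis i 1"
    unfolding s n o mult.assoc z vec_eq_iff using assms by (auto simp: equil_def axis_def)
  show ?thesis
  proof
    assume "eigenvalue_in_direction (simplex_field a) (equil j) i c"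
    then obtain L where "(simplex_field a has_derivative L) (at (equil j))"
      and c: "L (axis i 1) = c *\<^sub>R axis i 1"
      unfolding eigenvalue_in_direction_def by blast
    then have "L = ?L"
      using has_derivative_unique[OF _ D] by blast
    then have "(c *\<^sub>R axis i (1::real)) $ i = (a j i *\<^sub>R axis i 1) $ i"
      using c L by simp
    then show "c = a j i"
      by (simp add: axis_def)
  next
    assume "c = a j i"
    then show "eigenvalue_in_direction (simplex_field a) (equil j) i c"
      unfolding eigenvalue_in_direction_def using D L by (intro exI[of _ ?L]) simp
  qed
qed

text \<open>
  The positive transverse eigenvalues of \<open>C\<close>, indexed by the pairs \<open>(j, i)\<close> of an equilibrium
  \<open>\<xi>\<^sub>j\<close> of \<open>C\<close> and a transverse direction \<open>x\<^sub>i\<close> (neither radial, contracting nor expanding).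
\<close>

definition positive_transverse ::
    "('n::finite \<Rightarrow> 'n \<Rightarrow> real) \<Rightarrow> ('n \<times> 'n) list \<Rightarrow> ('n \<times> 'n) set" where
  "positive_transverse a C =
     {(j, i). j \<in> cycle_verts C \<and> i \<noteq> j \<and> (i, j) \<notin> set C \<and> (j, i) \<notin> set C \<and>
              (\<exists>c>0. eigenvalue_in_direction (simplex_field a) (equil j) i c)}"

end

theory Submission
  imports Defs "HOL-Real_Asymp.Real_Asymp"
begin

text \<open>
  The coefficients are chosen as \<open>1\<close> on the arcs of \<open>G'\<close> and \<open>- 1\<close> on all other pairs.  On a set of vertices any two
  of which are joined by an arc they are antisymmetric, and this makes the
  unstable manifolds computable without any existence theory for differential equations.

  Suppose that every vertex \<open>j\<close> forms a transitive tournament with its out-neighbours in \<open>G'\<close>.  A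
  solution emerging from \<open>\<xi>\<^sub>j\<close> has only coordinates in this tournament, since the other directions
  at \<open>\<xi>\<^sub>j\<close> are contracting (\<open>unstable_solution_vanishes\<close>), and it stays on the unit sphere, since by
  antisymmetry its squared norm solves a logistic equation (\<open>unstable_solution_unit\<close>).  On the
  sphere the sum of the squares of the coordinates of the first \<open>c\<close> vertices of the tournament again
  solves a logistic equation, for every \<open>c\<close>.  All trajectories are therefore explicit
  (\<open>tournament_flow\<close>), exist for all times, and converge to the equilibrium of the last vertex
  of their support, which is an out-neighbour of \<open>j\<close> unless the solution rests at \<open>\<xi>\<^sub>j\<close>.  So \<open>G'\<close>
  yields a complete network (\<open>complete_network_of_ranked_out_neighbours\<close>).

  It remains to complete \<open>G\<close> to such a \<open>G'\<close> without spoiling the count of eigenvalues.  Given the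
  cycle \<open>C\<close> and the other cycle \<open>D\<close>, let \<open>w\<close> be the last common vertex and \<open>p\<close> its successor in \<open>C\<close>,
  and let every vertex of \<open>D\<close> point to \<open>p\<close>.  The out-neighbours of a vertex of \<open>D\<close> become its successor in \<open>D\<close>
  and \<open>p\<close>, and the former points to the latter.  The length hypothesis ensures that neither
  \<open>p\<close> nor the successor of \<open>p\<close> lies on \<open>D\<close> (\<open>two_cycles_structure\<close>), which excludes 2-cycles.  A
  common vertex has exactly one outgoing arc outside \<open>C\<close>, and the other vertices of \<open>C\<close> have none.
\<close>

section \<open>The explicit flow on a transitive tournament\<close>

text \<open>
  The rank lists \<open>K\<close> in the order of a transitive tournament: every vertex beats all later
  ones.  Both values \<open>1\<close> and \<open>- 1\<close> are demanded of a pair, so that the restriction of \<open>a\<close> to \<open>K\<close> is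
  antisymmetric; this is what makes the flow on the unit sphere explicitly solvable.
\<close>

definition ranked_tournament :: "('n \<Rightarrow> 'n \<Rightarrow> real) \<Rightarrow> 'n set \<Rightarrow> ('n \<Rightarrow> nat) \<Rightarrow> bool" where
  "ranked_tournament a K r \<longleftrightarrow> inj_on r K \<and> (\<forall>i\<in>K. a i i = 0) \<and>
     (\<forall>l\<in>K. \<forall>i\<in>K. r l < r i \<longrightarrow> a l i = 1 \<and> a i l = -1)"

definition mass_below :: "'n::finite set \<Rightarrow> ('n \<Rightarrow> nat) \<Rightarrow> real ^ 'n \<Rightarrow> nat \<Rightarrow> real" where
  "mass_below K r y c = (\<Sum>l | l \<in> K \<and> r l < c. (y $ l)\<^sup>2)"

text \<open>
  The solution of the logistic equation \<open>T' = - 2 T (1 - T)\<close> with initial value \<open>T\<close> is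
  \<open>T / logistic_denom T t\<close>.
\<close>

definition logistic_denom :: "real \<Rightarrow> real \<Rightarrow> real" where
  "logistic_denom T t = T + (1 - T) * exp (2 * t)"

text \<open>
  The mass below rank \<open>c\<close> solves the logistic equation for every \<open>c\<close>.  The square of the \<open>i\<close>-th
  coordinate is the difference of the masses below \<open>r i + 1\<close> and below \<open>r i\<close>; brought over the
  common denominator this difference is a single product, whose square root is taken here.
\<close>

definition tournament_flow ::
    "'n::finite set \<Rightarrow> ('n \<Rightarrow> nat) \<Rightarrow> real ^ 'n \<Rightarrow> real \<Rightarrow> real ^ 'n" where
  "tournament_flow K r y t =
     (\<chi> i. y $ i * exp t / sqrt (logistic_denom (mass_below K r y (r i)) t *
                                 logistic_denom (mass_below K r y (Suc (r i))) t))"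

text \<open>
  The two shapes of the derivative of \<open>c exp t / sqrt (P t * Q t)\<close>: on the left as delivered by the
  quotient rule, with \<open>s = sqrt (P t * Q t)\<close>, \<open>P' = 2 (P - A)\<close> and \<open>Q' = 2 (Q - B)\<close>; on the right as
  it occurs in the vector field.
\<close>

lemma quotient_form:
  fixes s P Q A B c :: real
  assumes "s > 0" "P > 0" "Q > 0" and s: "s * s = P * Q"
  shows "(c * s - c * ((2 * (P - A) * Q + P * (2 * (Q - B))) / (2 * s))) / (s * s)
       = c / s * (A / P + B / Q - 1)"
proof -
  have "(c * s - c * ((2 * (P - A) * Q + P * (2 * (Q - B))) / (2 * s))) / (s * s)
     = c / s * (1 - ((P - A) * Q + P * (Q - B)) / (s * s))"
    using assms(1) by (simp add: field_simps)
  also have "1 - ((P - A) * Q + P * (Q - B)) / (s * s) = A / P + B / Q - 1"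
    unfolding s using assms(2,3) by (simp add: field_simps)
  finally show ?thesis .
qed

lemma norm_square_sum: "(norm (x :: real ^ 'n::finite))\<^sup>2 = (\<Sum>i\<in>UNIV. (x $ i)\<^sup>2)"
  unfolding power2_norm_eq_inner inner_vec_def by (simp add: power2_eq_square)

lemma logistic_denom_pos: "0 \<le> T \<Longrightarrow> T \<le> 1 \<Longrightarrow> 0 < logistic_denom T t"
  unfolding logistic_denom_def
  by (cases "T = 1") (auto intro: add_nonneg_pos)

lemma sum_eq_sum_support:
  fixes f :: "'n::finite \<Rightarrow> real"
  assumes "\<And>i. i \<notin> K \<Longrightarrow> f i = 0"
  shows "sum f UNIV = sum f K"
  using assms by (intro sum.mono_neutral_right) auto

lemma mass_below_0 [simp]: "mass_below K r y 0 = 0"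
  by (simp add: mass_below_def)

lemma mass_below_nonneg: "0 \<le> mass_below K r y c"
  by (simp add: mass_below_def sum_nonneg)

lemma mass_below_le_norm: "mass_below K r y c \<le> (norm y)\<^sup>2"
  unfolding mass_below_def norm_square_sum by (intro sum_mono2) auto

lemma mass_below_Suc:
  assumes "inj_on r K" "i \<in> K"
  shows "mass_below K r y (Suc (r i)) = mass_below K r y (r i) + (y $ i)\<^sup>2"
proof -
  have "{l \<in> K. r l < Suc (r i)} = insert i {l \<in> K. r l < r i}"
    using assms by (auto simp: less_Suc_eq dest: inj_onD)
  then show ?thesis
    by (simp add: mass_below_def)
qed

lemma mass_below_top:
  assumes "\<And>i. i \<notin> K \<Longrightarrow> y $ i = 0" and "\<And>i. y $ i \<noteq> 0 \<Longrightarrow> r i < c"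
  shows "mass_below K r y c = (norm y)\<^sup>2"
  unfolding mass_below_def norm_square_sum
  using assms by (intro sum.mono_neutral_left) auto

context
  fixes a :: "'n::finite \<Rightarrow> 'n \<Rightarrow> real" and K :: "'n set" and r :: "'n \<Rightarrow> nat"
    and y :: "real ^ 'n"
  assumes tournament: "ranked_tournament a K r"
    and unit: "norm y = 1"
    and orthant: "\<And>i. 0 \<le> y $ i"
    and support: "\<And>i. i \<notin> K \<Longrightarrow> y $ i = 0"
begin

private abbreviation "T \<equiv> mass_below K r y"
private abbreviation "flow \<equiv> tournament_flow K r y"

lemma T_pos: "0 < logistic_denom (T c) t"
  using mass_below_le_norm[of K r y c] by (intro logistic_denom_pos mass_below_nonneg) (simp add: unit)

lemma flow_support: "i \<notin> K \<Longrightarrow> flow t $ i = 0"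
  by (simp add: tournament_flow_def support)

lemma flow_nonneg: "0 \<le> flow t $ i"
  by (simp add: tournament_flow_def orthant less_imp_le[OF T_pos])

lemma flow_square:
  "(flow t $ i)\<^sup>2 = (y $ i)\<^sup>2 * exp (2 * t) / (logistic_denom (T (r i)) t * logistic_denom (T (Suc (r i))) t)"
  by (simp add: tournament_flow_def power_divide power_mult_distrib exp_double less_imp_le[OF T_pos])

text \<open>
  The masses of the flow are the logistic solutions; going up one rank adds one coordinate, and the
  sum telescopes.  Everything else about the flow follows from this identity.
\<close>

lemma flow_mass: "mass_below K r (flow t) c = T c / logistic_denom (T c) t"
proof (induction c)
  case (Suc c)
  show ?case
  proof (cases "\<exists>i\<in>K. r i = c")
    case True
    then obtain i where i: "i \<in> K" "r i = c" by blast
    have inj: "inj_on r K" using tournament by (simp add: ranked_tournament_def)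
    have e: "T (Suc c) = T c + (y $ i)\<^sup>2"
      using mass_below_Suc[OF inj i(1), of y] i by simp
    have "mass_below K r (flow t) (Suc c) = mass_below K r (flow t) c + (flow t $ i)\<^sup>2"
      using mass_below_Suc[OF inj i(1), of "flow t"] i by simp
    also have "\<dots> = T c / logistic_denom (T c) t
        + (T (Suc c) - T c) * exp (2 * t) / (logistic_denom (T c) t * logistic_denom (T (Suc c)) t)"
      unfolding Suc.IH flow_square i(2) using e by simp
    also have "\<dots> = (T c * logistic_denom (T (Suc c)) t + (T (Suc c) - T c) * exp (2 * t))
         / (logistic_denom (T c) t * logistic_denom (T (Suc c)) t)"
      using T_pos[of c t] T_pos[of "Suc c" t] by (simp add: add_divide_distrib)
    also have "T c * logistic_denom (T (Suc c)) t + (T (Suc c) - T c) * exp (2 * t) =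
        T (Suc c) * logistic_denom (T c) t"
      by (simp add: logistic_denom_def algebra_simps)
    finally show ?thesis
      using T_pos[of c t] T_pos[of "Suc c" t] by simp
  next
    case False
    then have "mass_below K r z (Suc c) = mass_below K r z c" for z
      unfolding mass_below_def by (intro sum.cong) (auto simp: less_Suc_eq)
    then show ?thesis using Suc.IH by simp
  qed
qed simp

lemma flow_unit: "(norm (flow t))\<^sup>2 = 1"
proof -
  define c where "c = Suc (Max (range r))"
  have c: "r i < c" for i
    by (simp add: c_def less_Suc_eq_le)
  have "T c = 1"
    using mass_below_top[of K y r c] support c by (simp add: unit)
  then show ?thesis
    using mass_below_top[of K "flow t" r c] flow_support c flow_mass[of t c]
    by (simp add: logistic_denom_def)
qed

lemma flow_0: "flow 0 = y"
  by (simp add: vec_eq_iff tournament_flow_def logistic_denom_def)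

text \<open>
  Mass of lower rank feeds \<open>i\<close>, mass of higher rank drains it, and the total mass is \<open>1\<close>.
\<close>

lemma flow_rate:
  assumes i: "i \<in> K"
  shows "(\<Sum>l\<in>UNIV. a l i * (flow t $ l)\<^sup>2) =
    mass_below K r (flow t) (r i) + mass_below K r (flow t) (Suc (r i)) - 1"
proof -
  let ?x = "\<lambda>l. (flow t $ l)\<^sup>2"
  have t: "inj_on r K" "a i i = 0" "\<And>l. l \<in> K \<Longrightarrow> r l < r i \<Longrightarrow> a l i = 1"
    "\<And>l. l \<in> K \<Longrightarrow> r i < r l \<Longrightarrow> a l i = -1"
    using tournament i by (auto simp: ranked_tournament_def)
  have e: "r l = r i \<Longrightarrow> l \<in> K \<Longrightarrow> l = i" for l
    using t(1) i by (auto dest: inj_onD)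
  have "(\<Sum>l\<in>UNIV. a l i * ?x l) = (\<Sum>l\<in>K. a l i * ?x l)"
    by (rule sum_eq_sum_support) (simp add: flow_support)
  also have "\<dots> = (\<Sum>l\<in>K. (if r l < r i then ?x l else 0) + (if r l < Suc (r i) then ?x l else 0) - ?x l)"
  proof (rule sum.cong[OF refl])
    fix l assume l: "l \<in> K"
    consider "r l < r i" | "l = i" | "r i < r l" using e[OF _ l] by linarith
    then show "a l i * ?x l = (if r l < r i then ?x l else 0) + (if r l < Suc (r i) then ?x l else 0) - ?x l"
      by cases (use t l in auto)
  qed
  also have "\<dots> = mass_below K r (flow t) (r i) + mass_below K r (flow t) (Suc (r i)) - sum ?x K"
    by (simp add: sum.distrib sum_subtractf mass_below_def sum.If_cases Int_def conj_commute)
  also have "sum ?x K = 1"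
    using flow_unit[of t] sum_eq_sum_support[of K ?x] by (simp add: norm_square_sum flow_support)
  finally show ?thesis .
qed

lemma flow_component_derivative:
  assumes i: "i \<in> K"
  shows "((\<lambda>t. flow t $ i) has_real_derivative simplex_field a (flow t) $ i) (at t within S)"
proof -
  let ?P = "logistic_denom (T (r i))" and ?Q = "logistic_denom (T (Suc (r i)))"
  have P: "0 < ?P t" "0 < ?Q t" by (rule T_pos)+
  have d: "(logistic_denom c has_real_derivative 2 * (logistic_denom c t - c)) (at t within S)" for c
    unfolding logistic_denom_def by (auto intro!: derivative_eq_intros)
  have "((\<lambda>t. y $ i * exp t / sqrt (?P t * ?Q t)) has_real_derivative
     y $ i * exp t / sqrt (?P t * ?Q t) * (T (r i) / ?P t + T (Suc (r i)) / ?Q t - 1)) (at t within S)"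
  proof -
    have s: "sqrt (?P t * ?Q t) * sqrt (?P t * ?Q t) = ?P t * ?Q t" "sqrt (?P t * ?Q t) > 0"
      using P by auto
    have "((\<lambda>t. ?P t * ?Q t) has_real_derivative
        2 * (?P t - T (r i)) * ?Q t + ?P t * (2 * (?Q t - T (Suc (r i))))) (at t within S)"
      by (rule DERIV_cong[OF DERIV_mult[OF d d]]) (simp add: algebra_simps)
    from DERIV_chain2[OF DERIV_real_sqrt this]
    have "((\<lambda>t. sqrt (?P t * ?Q t)) has_real_derivative
        (2 * (?P t - T (r i)) * ?Q t + ?P t * (2 * (?Q t - T (Suc (r i))))) / (2 * sqrt (?P t * ?Q t)))
        (at t within S)"
      using P s(2) by (simp add: field_simps)
    then have "((\<lambda>t. y $ i * exp t / sqrt (?P t * ?Q t)) has_real_derivative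
       (y $ i * exp t * sqrt (?P t * ?Q t) - y $ i * exp t *
         ((2 * (?P t - T (r i)) * ?Q t + ?P t * (2 * (?Q t - T (Suc (r i))))) / (2 * sqrt (?P t * ?Q t))))
       / (sqrt (?P t * ?Q t) * sqrt (?P t * ?Q t))) (at t within S)"
      by (rule DERIV_divide[OF DERIV_cmult[OF has_field_derivative_at_within[OF DERIV_exp]]])
         (use P in auto)
    also have "(y $ i * exp t * sqrt (?P t * ?Q t) - y $ i * exp t *
         ((2 * (?P t - T (r i)) * ?Q t + ?P t * (2 * (?Q t - T (Suc (r i))))) / (2 * sqrt (?P t * ?Q t))))
       / (sqrt (?P t * ?Q t) * sqrt (?P t * ?Q t)) =
       y $ i * exp t / sqrt (?P t * ?Q t) * (T (r i) / ?P t + T (Suc (r i)) / ?Q t - 1)"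
      by (rule quotient_form) (use P s in auto)
    finally show ?thesis .
  qed
  moreover have "simplex_field a (flow t) $ i =
      y $ i * exp t / sqrt (?P t * ?Q t) * (T (r i) / ?P t + T (Suc (r i)) / ?Q t - 1)"
    by (simp add: simplex_field_def flow_unit flow_rate[OF i] flow_mass) (simp add: tournament_flow_def)
  ultimately show ?thesis by (simp add: tournament_flow_def)
qed

lemma flow_orthant_solution: "orthant_solution a S flow"
proof -
  have "(flow has_vector_derivative simplex_field a (flow t)) (at t within S)" for t
    unfolding has_vector_derivative_def
  proof (rule iffD2[OF has_derivative_componentwise_within], rule ballI)
    fix b :: "real ^ 'n" assume "b \<in> Basis"
    then obtain i where b: "b = axis i 1" by (auto simp: Basis_vec_def)
    have "((\<lambda>t. flow t $ i) has_real_derivative simplex_field a (flow t) $ i) (at t within S)"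
    proof (cases "i \<in> K")
      case False
      then show ?thesis by (simp add: flow_support simplex_field_def)
    qed (rule flow_component_derivative)
    then show "((\<lambda>t. flow t \<bullet> b) has_derivative (\<lambda>h. (h *\<^sub>R simplex_field a (flow t)) \<bullet> b)) (at t within S)"
      by (simp add: b inner_axis has_field_derivative_def mult.commute[of _ "simplex_field a (flow t) $ i"])
  qed
  then show ?thesis
    by (simp add: orthant_solution_def flow_nonneg)
qed

lemma tendsto_equil_if_square:
  assumes "((\<lambda>t. (flow t $ q)\<^sup>2) \<longlongrightarrow> 1) F"
  shows "(flow \<longlongrightarrow> equil q) F"
proof (rule vec_tendstoI)
  fix i
  have q: "((\<lambda>t. flow t $ q) \<longlongrightarrow> 1) F"
    using tendsto_real_sqrt[OF assms] flow_nonneg by simp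
  show "((\<lambda>t. flow t $ i) \<longlongrightarrow> equil q $ i) F"
  proof (cases "i = q")
    case False
    have "(flow t $ i)\<^sup>2 \<le> 1 - (flow t $ q)\<^sup>2" for t
    proof -
      have "(\<Sum>l\<in>{i, q}. (flow t $ l)\<^sup>2) \<le> (\<Sum>l\<in>UNIV. (flow t $ l)\<^sup>2)"
        by (intro sum_mono2) auto
      then show ?thesis using False flow_unit[of t] by (simp add: norm_square_sum)
    qed
    then have le: "\<forall>\<^sub>F t in F. (flow t $ i)\<^sup>2 \<le> 1 - (flow t $ q)\<^sup>2"
      by (intro always_eventually allI)
    have "((\<lambda>t. 1 - (flow t $ q)\<^sup>2) \<longlongrightarrow> 0) F"
      using tendsto_diff[OF tendsto_const assms, of 1] by simp
    from tendsto_sandwich[OF _ le tendsto_const[of 0] this]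
    have "((\<lambda>t. (flow t $ i)\<^sup>2) \<longlongrightarrow> 0) F"
      by simp
    from tendsto_real_sqrt[OF this] show ?thesis
      using False flow_nonneg by (simp add: equil_def axis_def)
  qed (use q in \<open>simp add: equil_def\<close>)
qed

text \<open>
  The last vertex of the support beats all others, so its square solves a logistic equation that
  increases to \<open>1\<close>; the unit sphere leaves no room for the other coordinates.  Backwards in time
  the same happens at the first vertex.
\<close>

lemma flow_tendsto_top:
  assumes q: "y $ q > 0" and top: "\<And>i. y $ i > 0 \<Longrightarrow> r i \<le> r q"
  shows "(flow \<longlongrightarrow> equil q) at_top"
proof (rule tendsto_equil_if_square)
  define b where "b = (y $ q)\<^sup>2"
  have qK: "q \<in> K" using q support by force
  have "T (Suc (r q)) = 1"
  proof -
    have "r i < Suc (r q)" if "y $ i \<noteq> 0" for i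
      using top[of i] orthant[of i] that by simp
    then show ?thesis
      using mass_below_top[of K y r "Suc (r q)"] support by (simp add: unit)
  qed
  moreover from this have "T (r q) = 1 - b"
    using mass_below_Suc[of r K q y] tournament qK by (simp add: ranked_tournament_def b_def)
  ultimately have "(flow t $ q)\<^sup>2 = b * exp (2 * t) / (1 - b + b * exp (2 * t))" for t
    unfolding flow_square by (simp add: logistic_denom_def b_def)
  moreover have "b > 0" using q by (simp add: b_def)
  then have "((\<lambda>t. b * exp (2 * t) / (1 - b + b * exp (2 * t))) \<longlongrightarrow> 1) at_top"
    by real_asymp
  ultimately show "((\<lambda>t. (flow t $ q)\<^sup>2) \<longlongrightarrow> 1) at_top" by simp
qed

lemma flow_tendsto_bot:
  assumes q: "y $ q > 0" and bot: "\<And>i. y $ i > 0 \<Longrightarrow> r q \<le> r i"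
  shows "(flow \<longlongrightarrow> equil q) at_bot"
proof (rule tendsto_equil_if_square)
  define b where "b = (y $ q)\<^sup>2"
  have qK: "q \<in> K" using q support by force
  have T0: "T (r q) = 0"
    unfolding mass_below_def
  proof (rule sum.neutral, clarify)
    fix l assume "r l < r q"
    with bot[of l] have "\<not> y $ l > 0" by linarith
    with orthant[of l] show "(y $ l)\<^sup>2 = 0" by simp
  qed
  moreover from this have "T (Suc (r q)) = b"
    using mass_below_Suc[of r K q y] tournament qK by (simp add: ranked_tournament_def b_def)
  ultimately have "(flow t $ q)\<^sup>2 = b / (b + (1 - b) * exp (2 * t))" for t
    unfolding flow_square by (simp add: logistic_denom_def b_def)
  moreover have "b > 0" using q by (simp add: b_def)
  then have "((\<lambda>t. b / (b + (1 - b) * exp (2 * t))) \<longlongrightarrow> 1) at_bot"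
    by real_asymp
  ultimately show "((\<lambda>t. (flow t $ q)\<^sup>2) \<longlongrightarrow> 1) at_bot" by simp
qed

end


section \<open>Unstable manifolds\<close>

text \<open>
  One-sided derivatives at the ends of an interval suffice for monotonicity.  They are the only ones
  available, since solutions are differentiated within a closed half-line.
\<close>

lemma antimono_of_nonpos_derivative:
  fixes f :: "real \<Rightarrow> real"
  assumes der: "\<And>t. t \<in> {s..u} \<Longrightarrow> (f has_real_derivative f' t) (at t within {s..u})"
    and neg: "\<And>t. t \<in> {s..u} \<Longrightarrow> f' t \<le> 0" and "s \<le> u"
  shows "f u \<le> f s"
proof (rule DERIV_nonpos_imp_decreasing_open[OF \<open>s \<le> u\<close>])
  show "continuous_on {s..u} f"
    using DERIV_continuous[OF der] by (auto simp: continuous_on_eq_continuous_within)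
  fix t assume t: "s < t" "t < u"
  then have "(f has_real_derivative f' t) (at t)"
    using der[of t] at_within_Icc_at[of s t u] by simp
  then show "\<exists>z. (f has_real_derivative z) (at t) \<and> z \<le> 0"
    using neg[of t] t by auto
qed

lemma le_limit_at_bot_of_nonpos_derivative:
  fixes f :: "real \<Rightarrow> real"
  assumes der: "\<And>t. t \<le> b \<Longrightarrow> (f has_real_derivative f' t) (at t within {..b})"
    and neg: "\<And>t. t \<le> b \<Longrightarrow> f' t \<le> 0"
    and lim: "(f \<longlongrightarrow> L) at_bot" and t: "t \<le> b"
  shows "f t \<le> L"
proof (rule tendsto_lowerbound[OF lim])
  have "f t \<le> f s" if "s \<le> t" for s
    by (rule antimono_of_nonpos_derivative[where f = f and f' = f'])
       (use neg t that in \<open>auto intro!: has_field_derivative_subset[OF der]\<close>)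
  then show "\<forall>\<^sub>F s in at_bot. f t \<le> f s"
    by (auto intro: eventually_mono[OF eventually_le_at_bot[of t]])
qed simp

text \<open>
  Near \<open>-\<infinity>\<close> a negative rate makes a nonnegative solution of \<open>y' = y g\<close> nonincreasing, so it cannot
  come from the limit \<open>0\<close> without being \<open>0\<close>; and a solution of a linear equation that vanishes once
  vanishes afterwards.
\<close>

lemma linear_decay_vanishes:
  fixes y g :: "real \<Rightarrow> real"
  assumes der: "\<And>t. t \<le> 0 \<Longrightarrow> (y has_real_derivative y t * g t) (at t within {..0})"
    and nonneg: "\<And>t. t \<le> 0 \<Longrightarrow> 0 \<le> y t"
    and lim: "(y \<longlongrightarrow> 0) at_bot"
    and g: "continuous_on {..0} g" "(g \<longlongrightarrow> c) at_bot" "c < 0"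
    and "t \<le> 0"
  shows "y t = 0"
proof -
  obtain b where b: "b \<le> 0" "\<And>s. s \<le> b \<Longrightarrow> g s < 0"
  proof -
    from order_tendstoD(2)[OF g(2,3)] obtain N where "\<And>s. s \<le> N \<Longrightarrow> g s < 0"
      by (auto simp: eventually_at_bot_linorder)
    then show ?thesis using that[of "min N 0"] by simp
  qed
  have early: "y s = 0" if "s \<le> b" for s
  proof -
    have "y s \<le> 0"
      by (rule le_limit_at_bot_of_nonpos_derivative[where f = y and b = b and f' = "\<lambda>t. y t * g t"])
         (use b lim that nonneg in \<open>auto intro!: has_field_derivative_subset[OF der] mult_nonneg_nonpos
            simp: less_imp_le\<close>)
    then show ?thesis using nonneg[of s] b that by simp
  qed
  show ?thesis
  proof (cases "t \<le> b")
    case False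
    have "compact (g ` {b..0})"
      by (intro compact_continuous_image continuous_on_subset[OF g(1)]) auto
    then obtain M where M: "\<And>s. s \<in> {b..0} \<Longrightarrow> g s \<le> M"
      using bounded_imp_bdd_above[OF compact_imp_bounded] by (metis bdd_above.E imageI)
    \<comment> \<open>Once zero, always zero: damping by an upper bound \<open>M\<close> of the rate makes \<open>y\<close> nonincreasing.\<close>
    have "y t * exp (- M * t) \<le> y b * exp (- M * b)"
    proof (rule antimono_of_nonpos_derivative[where f = "\<lambda>s. y s * exp (- M * s)"
          and f' = "\<lambda>s. y s * (g s - M) * exp (- M * s)"])
      fix s assume s: "s \<in> {b..t}"
      have "(y has_real_derivative y s * g s) (at s within {b..t})"
        by (rule has_field_derivative_subset[OF der]) (use s \<open>t \<le> 0\<close> in auto)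
      then show "((\<lambda>s. y s * exp (- M * s)) has_real_derivative y s * (g s - M) * exp (- M * s))
          (at s within {b..t})"
        by (auto intro!: derivative_eq_intros simp: algebra_simps)
      show "y s * (g s - M) * exp (- M * s) \<le> 0"
        using M[of s] nonneg[of s] s \<open>t \<le> 0\<close>
        by (intro mult_nonpos_nonneg mult_nonneg_nonpos) auto
    qed (use False in simp)
    then have "y t * exp (- M * t) \<le> 0" by (simp add: early)
    then show ?thesis using nonneg[OF \<open>t \<le> 0\<close>] by (simp add: mult_le_0_iff)
  qed (use early in simp)
qed

lemma simplex_field_component:
  assumes "(x has_vector_derivative simplex_field a (x t)) (at t within S)"
  shows "((\<lambda>t. x t $ i) has_real_derivative
    x t $ i * (1 - (norm (x t))\<^sup>2 + (\<Sum>j\<in>UNIV. a j i * (x t $ j)\<^sup>2))) (at t within S)"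
  using bounded_linear.has_vector_derivative[OF bounded_linear_vec_nth assms, of i]
  by (simp add: has_real_derivative_iff_has_vector_derivative simplex_field_def)

text \<open>
  The logarithmic growth rate of \<open>x\<^sub>i\<close> near \<open>\<xi>\<^sub>j\<close> is the eigenvalue of \<open>\<xi>\<^sub>j\<close> in direction \<open>x\<^sub>i\<close>.
\<close>

lemma rate_tendsto_eigenvalue:
  assumes "(x \<longlongrightarrow> equil j) F"
  shows "((\<lambda>t. 1 - (norm (x t))\<^sup>2 + (\<Sum>l\<in>UNIV. a l i * (x t $ l)\<^sup>2)) \<longlongrightarrow> a j i) F"
proof -
  have "((\<lambda>t. 1 - (norm (x t))\<^sup>2 + (\<Sum>l\<in>UNIV. a l i * (x t $ l)\<^sup>2)) \<longlongrightarrow>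
      1 - (norm (equil j))\<^sup>2 + (\<Sum>l\<in>UNIV. a l i * (equil j $ l)\<^sup>2)) F"
    by (intro tendsto_intros assms tendsto_vec_nth)
  moreover have "a l i * (equil j $ l)\<^sup>2 = (if l = j then a j i else 0)" for l
    by (simp add: equil_def axis_def)
  ultimately show ?thesis by (simp add: equil_def norm_axis_1)
qed

lemma unstable_solution_vanishes:
  assumes sol: "orthant_solution a {..0} x" and lim: "(x \<longlongrightarrow> equil j) at_bot"
    and i: "i \<noteq> j" "a j i < 0" and t: "t \<le> 0"
  shows "x t $ i = 0"
proof (rule linear_decay_vanishes[where y = "\<lambda>t. x t $ i"
      and g = "\<lambda>t. 1 - (norm (x t))\<^sup>2 + (\<Sum>l\<in>UNIV. a l i * (x t $ l)\<^sup>2)" and c = "a j i"])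
  show "((\<lambda>t. x t $ i) has_real_derivative
    x t $ i * (1 - (norm (x t))\<^sup>2 + (\<Sum>j\<in>UNIV. a j i * (x t $ j)\<^sup>2))) (at t within {..0})"
    if "t \<le> 0" for t
    using sol that by (intro simplex_field_component) (auto simp: orthant_solution_def)
  show "((\<lambda>t. x t $ i) \<longlongrightarrow> 0) at_bot"
    using tendsto_vec_nth[OF lim, of i] i by (simp add: equil_def axis_def)
  have "continuous_on {..0} x"
    using sol has_vector_derivative_continuous
    by (fastforce simp: orthant_solution_def continuous_on_eq_continuous_within)
  then show "continuous_on {..0} (\<lambda>t. 1 - (norm (x t))\<^sup>2 + (\<Sum>l\<in>UNIV. a l i * (x t $ l)\<^sup>2))"
    by (intro continuous_intros)
qed (use sol i t rate_tendsto_eigenvalue[OF lim] in \<open>auto simp: orthant_solution_def\<close>)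

text \<open>
  An exchange of mass between two coordinates with \<open>a l i = - a i l\<close> is lossless.  The coefficients thus
  drop out of the equation for \<open>|x|\<^sup>2\<close>.
\<close>

lemma antisymmetric_growth_sum:
  fixes a :: "'n::finite \<Rightarrow> 'n \<Rightarrow> real" and x :: "real ^ 'n"
  assumes "\<And>i l. i \<in> K \<Longrightarrow> l \<in> K \<Longrightarrow> a l i = - a i l" and "\<And>i. i \<notin> K \<Longrightarrow> x $ i = 0"
  shows "(\<Sum>i\<in>UNIV. \<Sum>l\<in>UNIV. a l i * (x $ l)\<^sup>2 * (x $ i)\<^sup>2) = 0" (is "?S = 0")
proof -
  have "a l i * (x $ l)\<^sup>2 * (x $ i)\<^sup>2 = - (a i l * (x $ i)\<^sup>2 * (x $ l)\<^sup>2)" for i l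
  proof (cases "i \<in> K \<and> l \<in> K")
    case True
    then have "a l i = - a i l" by (intro assms(1)) auto
    then show ?thesis by (simp add: mult.assoc mult.commute[of "(x $ l)\<^sup>2"])
  qed (use assms(2) in auto)
  then have "?S = (\<Sum>i\<in>UNIV. \<Sum>l\<in>UNIV. - (a i l * (x $ i)\<^sup>2 * (x $ l)\<^sup>2))"
    by (intro sum.cong refl)
  also have "\<dots> = - (\<Sum>i\<in>UNIV. \<Sum>l\<in>UNIV. a i l * (x $ i)\<^sup>2 * (x $ l)\<^sup>2)"
    by (simp add: sum_negf)
  also have "(\<Sum>i\<in>UNIV. \<Sum>l\<in>UNIV. a i l * (x $ i)\<^sup>2 * (x $ l)\<^sup>2) = ?S"
    by (rule sum.swap)
  finally show ?thesis by simp
qed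

text \<open>
  With antisymmetric coefficients \<open>s = |x|\<^sup>2\<close> solves \<open>s' = 2 s (1 - s)\<close>, for which \<open>(s - 1)\<^sup>2\<close> is
  nonincreasing.  As it tends to \<open>0\<close> at \<open>-\<infinity>\<close>, it is \<open>0\<close>: the radial direction at \<open>\<xi>\<^sub>j\<close> is
  contracting, and an unstable manifold stays on the unit sphere.
\<close>

lemma unstable_solution_unit:
  assumes sol: "orthant_solution a {..0} x" and lim: "(x \<longlongrightarrow> equil j) at_bot"
    and anti: "\<And>i l. i \<in> K \<Longrightarrow> l \<in> K \<Longrightarrow> a l i = - a i l"
    and supp: "\<And>t i. t \<le> 0 \<Longrightarrow> i \<notin> K \<Longrightarrow> x t $ i = 0" and t: "t \<le> 0"
  shows "norm (x t) = 1"
proof -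
  let ?u = "\<lambda>t. (norm (x t))\<^sup>2 - 1"
  have d: "(?u has_real_derivative - 2 * (norm (x s))\<^sup>2 * ?u s) (at s within {..0})" if s: "s \<le> 0" for s
  proof -
    have "((\<lambda>t. x t $ i) has_real_derivative
      x s $ i * (1 - (norm (x s))\<^sup>2 + (\<Sum>j\<in>UNIV. a j i * (x s $ j)\<^sup>2))) (at s within {..0})" for i
      using sol s by (intro simplex_field_component) (auto simp: orthant_solution_def)
    then have "((\<lambda>t. (x t $ i)\<^sup>2) has_real_derivative
      2 * (x s $ i)\<^sup>2 * (1 - (norm (x s))\<^sup>2 + (\<Sum>j\<in>UNIV. a j i * (x s $ j)\<^sup>2))) (at s within {..0})" for i
      by (auto intro!: derivative_eq_intros simp: power2_eq_square)
    then have "((\<lambda>t. (norm (x t))\<^sup>2) has_real_derivative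
      (\<Sum>i\<in>UNIV. 2 * (x s $ i)\<^sup>2 * (1 - (norm (x s))\<^sup>2 + (\<Sum>j\<in>UNIV. a j i * (x s $ j)\<^sup>2)))) (at s within {..0})"
      unfolding norm_square_sum by (intro DERIV_sum)
    also have "(\<Sum>i\<in>UNIV. 2 * (x s $ i)\<^sup>2 * (1 - (norm (x s))\<^sup>2 + (\<Sum>j\<in>UNIV. a j i * (x s $ j)\<^sup>2))) =
      (\<Sum>i\<in>UNIV. 2 * (1 - (norm (x s))\<^sup>2) * (x s $ i)\<^sup>2
         + 2 * (\<Sum>j\<in>UNIV. a j i * (x s $ j)\<^sup>2 * (x s $ i)\<^sup>2))"
      by (intro sum.cong refl) (simp add: algebra_simps sum_distrib_left)
    also have "\<dots> = 2 * (1 - (norm (x s))\<^sup>2) * (norm (x s))\<^sup>2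
        + 2 * (\<Sum>i\<in>UNIV. \<Sum>j\<in>UNIV. a j i * (x s $ j)\<^sup>2 * (x s $ i)\<^sup>2)"
      by (simp add: sum.distrib sum_distrib_left[symmetric] norm_square_sum[symmetric])
    also have "\<dots> = 2 * (1 - (norm (x s))\<^sup>2) * (norm (x s))\<^sup>2"
      using antisymmetric_growth_sum[of K a "x s", OF anti supp[OF s]] by simp
    finally show ?thesis
      by (rule DERIV_cong[OF DERIV_diff[OF _ DERIV_const]]) (simp add: algebra_simps)
  qed
  have "(?u t)\<^sup>2 \<le> 0"
  proof (rule le_limit_at_bot_of_nonpos_derivative[where b = 0 and f = "\<lambda>t. (?u t)\<^sup>2"
        and f' = "\<lambda>t. - 4 * (norm (x t))\<^sup>2 * (?u t)\<^sup>2"])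
    show "((\<lambda>t. (?u t)\<^sup>2) has_real_derivative - 4 * (norm (x s))\<^sup>2 * (?u s)\<^sup>2) (at s within {..0})"
      if "s \<le> 0" for s
      by (rule DERIV_cong[OF DERIV_power[OF d[OF that], of 2]]) (simp add: power2_eq_square)
    have "((\<lambda>t. (?u t)\<^sup>2) \<longlongrightarrow> ((norm (equil j))\<^sup>2 - 1)\<^sup>2) at_bot"
      by (intro tendsto_intros lim)
    then show "((\<lambda>t. (?u t)\<^sup>2) \<longlongrightarrow> 0) at_bot"
      by (simp add: equil_def norm_axis_1)
  qed (use t in auto)
  then show ?thesis by (simp add: abs_square_eq_1)
qed

lemma ranked_tournament_antisymmetric:
  assumes "ranked_tournament a K r" "i \<in> K" "l \<in> K"
  shows "a l i = - a i l"
proof -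
  consider "r l < r i" | "r i < r l" | "l = i"
    using assms by (metis inj_onD linorder_neqE_nat ranked_tournament_def)
  then show ?thesis
    by cases (use assms in \<open>auto simp: ranked_tournament_def\<close>)
qed

lemma half_half_unit:
  assumes "j \<noteq> i"
  shows "norm (\<chi> k. if k = j \<or> k = i then sqrt (1/2) else 0 :: real ^ 'n::finite) = 1"
proof -
  have "(norm (\<chi> k. if k = j \<or> k = i then sqrt (1/2) else 0 :: real ^ 'n))\<^sup>2 = (\<Sum>k\<in>{j, i}. 1/2)"
    unfolding norm_square_sum
    by (intro sum.mono_neutral_cong_right) auto
  then show ?thesis using assms by (simp add: abs_square_eq_1)
qed

text \<open>
  The two end points of an arc form a transitive tournament.  Its explicit flow, started half way
  between the two equilibria, is the connection.
\<close>

lemma planar_connection_of_arc: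
  fixes a :: "'n::finite \<Rightarrow> 'n \<Rightarrow> real"
  assumes "j \<noteq> i" "a i i = 0" "a j j = 0" "a j i = 1" "a i j = - 1"
  shows "planar_connection a j i"
proof -
  define y :: "real ^ 'n" where "y = (\<chi> k. if k = j \<or> k = i then sqrt (1/2) else 0)"
  define r :: "'n \<Rightarrow> nat" where "r k = (if k = j then 0 else 1)" for k
  have K: "ranked_tournament a {j, i} r"
    using assms by (auto simp: ranked_tournament_def r_def)
  have y: "norm y = 1" "\<And>k. 0 \<le> y $ k" "\<And>k. k \<notin> {j, i} \<Longrightarrow> y $ k = 0"
    using half_half_unit[OF assms(1)] by (auto simp: y_def)
  show ?thesis
    unfolding planar_connection_def
  proof (intro exI conjI allI impI)
    show "orthant_solution a UNIV (tournament_flow {j, i} r y)"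
      by (rule flow_orthant_solution[OF K y])
    show "tournament_flow {j, i} r y t $ k = 0" if "k \<noteq> j" "k \<noteq> i" for t k
      by (rule flow_support[OF K y]) (use that in auto)
    show "(tournament_flow {j, i} r y \<longlongrightarrow> equil j) at_bot"
      by (rule flow_tendsto_bot[OF K y]) (auto simp: y_def r_def)
    show "(tournament_flow {j, i} r y \<longlongrightarrow> equil i) at_top"
      by (rule flow_tendsto_top[OF K y]) (use assms in \<open>auto simp: y_def r_def\<close>)
  qed
qed

text \<open>
  The completeness criterion.  The unstable manifold of \<open>\<xi>\<^sub>j\<close> lies in the coordinate subspace of \<open>j\<close>
  and its out-neighbours, because the other directions have negative eigenvalues, and on the unit
  sphere.  If these vertices form a transitive tournament, every point there has an explicit forward
  trajectory, which converges to the equilibrium of the last vertex at which the point is positive.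
  That vertex is \<open>j\<close> itself only at \<open>\<xi>\<^sub>j\<close>, and otherwise an out-neighbour of \<open>j\<close>.
\<close>

lemma complete_network_of_ranked_out_neighbours:
  fixes G :: "'n::finite pair_pre_digraph"
  assumes coeff: "simplex_coefficients G a"
    and rank: "\<And>j. ranked_tournament a (insert j (parcs G `` {j})) (r j)"
  shows "complete_network G a"
  unfolding complete_network_def
proof (intro allI subsetI)
  fix j z assume z: "z \<in> unstable_manifold a (equil j)"
  then obtain x where x: "orthant_solution a {..0} x" "(x \<longlongrightarrow> equil j) at_bot" "x 0 = z"
    by (auto simp: unstable_manifold_def)
  let ?K = "insert j (parcs G `` {j})"
  have supp: "x t $ i = 0" if "t \<le> 0" "i \<notin> ?K" for t i
    using unstable_solution_vanishes[OF x(1,2) _ _ that(1)] that(2) coeff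
    by (auto simp: simplex_coefficients_def)
  have unit: "norm z = 1"
    unfolding x(3)[symmetric]
  proof (rule unstable_solution_unit[OF x(1,2), where K = ?K])
    show "a l i = - a i l" if "i \<in> ?K" "l \<in> ?K" for i l
      by (rule ranked_tournament_antisymmetric[OF rank that])
  qed (rule supp, auto)
  have nonneg: "0 \<le> z $ i" for i using x by (auto simp: orthant_solution_def)
  have suppz: "z $ i = 0" if "i \<notin> ?K" for i using supp[of 0 i] that x(3) by auto
  have "\<exists>k. z $ k \<noteq> 0"
  proof (rule ccontr)
    assume "\<not> ?thesis"
    then have "(norm z)\<^sup>2 = 0" unfolding norm_square_sum by simp
    with unit show False by simp
  qed
  then obtain k where "z $ k > 0"
    using nonneg by (metis less_le)
  then have "Max (r j ` {i. z $ i > 0}) \<in> r j ` {i. z $ i > 0}"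
    by (intro Max_in) auto
  then obtain q where "z $ q > 0" "r j q = Max (r j ` {i. z $ i > 0})"
    by auto
  then have q: "z $ q > 0" "\<And>i. z $ i > 0 \<Longrightarrow> r j i \<le> r j q"
    by auto
  have "(tournament_flow ?K (r j) z \<longlongrightarrow> equil q) at_top"
    by (rule flow_tendsto_top[OF rank unit nonneg suppz q])
  moreover have "orthant_solution a {0..} (tournament_flow ?K (r j) z)"
    by (rule flow_orthant_solution[OF rank unit nonneg suppz])
  moreover have "tournament_flow ?K (r j) z 0 = z"
    by (rule flow_0[OF rank unit nonneg suppz])
  ultimately have stable: "z \<in> stable_manifold a (equil q)"
    unfolding stable_manifold_def by (intro CollectI exI conjI) auto
  show "z \<in> network G a"
  proof (cases "q = j")
    case True
    have "z $ i = 0" if "i \<noteq> j" for i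
    proof (rule ccontr)
      assume "z $ i \<noteq> 0"
      then have pos: "z $ i > 0" and arc: "(j, i) \<in> parcs G"
        using nonneg[of i] suppz[of i] that by auto
      then have "a j i > 0" "r j i \<le> r j j"
        using coeff that q(2)[OF pos] True by (auto simp: simplex_coefficients_def)
      moreover have "r j i \<noteq> r j j"
        using rank[of j] arc that inj_onD[of "r j" ?K i j] by (auto simp: ranked_tournament_def)
      ultimately show False
        using rank[of j] arc by (auto simp: ranked_tournament_def)
    qed
    then have "(norm z)\<^sup>2 = (\<Sum>i\<in>{j}. (z $ i)\<^sup>2)"
      unfolding norm_square_sum by (intro sum.mono_neutral_right) auto
    then have "z $ j = 1"
      using unit nonneg[of j] by (simp add: abs_square_eq_1)
    then have "z = equil j"
      using \<open>\<And>i. i \<noteq> j \<Longrightarrow> z $ i = 0\<close> by (simp add: vec_eq_iff equil_def axis_def)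
    then show ?thesis by (simp add: network_def)
  next
    case False
    then have "(j, q) \<in> parcs G"
      using suppz[of q] q(1) by auto
    then show ?thesis
      using z stable by (auto simp: network_def connection_set_def)
  qed
qed


section \<open>Directed cycles as lists of arcs\<close>

lemma pcas_append [simp]: "pcas u (p @ q) v \<longleftrightarrow> (\<exists>w. pcas u p w \<and> pcas w q v)"
  by (induction p arbitrary: u) auto

lemma pcas_heads: "pcas u p v \<Longrightarrow> u # map snd p = map fst p @ [v]"
  by (induction p arbitrary: u) auto

lemma pcas_last: "pcas u p v \<Longrightarrow> p \<noteq> [] \<Longrightarrow> snd (last p) = v"
  by (induction p arbitrary: u) (auto split: if_splits)

lemma pcas_pawalk_verts: "pcas u p v \<Longrightarrow> pawalk_verts u p = u # map snd p"
  by (induction p arbitrary: u) auto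

text \<open>
  A directed cycle with a marked initial vertex.  Distinctness is asked of the tails, so that every vertex of
  the cycle is the tail of exactly one arc.
\<close>

definition closed_path :: "'a \<Rightarrow> ('a \<times> 'a) list \<Rightarrow> bool" where
  "closed_path u p \<longleftrightarrow> p \<noteq> [] \<and> pcas u p u \<and> distinct (map fst p)"

lemma closed_path_mset: "pcas u p u \<Longrightarrow> mset (map snd p) = mset (map fst p)"
  using pcas_heads[of u p u, THEN arg_cong[where f = mset]] by simp

lemma closed_path_heads: "pcas u p u \<Longrightarrow> snd ` set p = fst ` set p"
  using closed_path_mset[of u p, THEN arg_cong[where f = set_mset]] by simp

lemma closed_path_head: "closed_path u p \<Longrightarrow> (v, x) \<in> set p \<Longrightarrow> x \<in> fst ` set p"
  using closed_path_heads[of u p] by (metis closed_path_def image_eqI snd_conv)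

lemma cycle_iff_closed_path:
  assumes "pair_wf_digraph G"
  shows "pre_digraph.cycle (with_proj G) p \<longleftrightarrow> set p \<subseteq> parcs G \<and> (\<exists>u. closed_path u p)"
proof -
  interpret pair_wf_digraph G by fact
  have e: "distinct (map snd p) \<longleftrightarrow> distinct (map fst p)" if "pcas u p u" for u
    using closed_path_mset[OF that] by (metis mset_eq_imp_distinct_iff)
  have v: "u \<in> pverts G" if "pcas u p u" "p \<noteq> []" "set p \<subseteq> parcs G" for u
    using that by (cases p) (auto dest: arc_fst_in_verts)
  show ?thesis
    unfolding cycle_def awalk_def closed_path_def
  proof (intro iffI conjI)
    assume "\<exists>u. (u \<in> pverts G \<and> set p \<subseteq> parcs G \<and> pcas u p u) \<and>
        distinct (tl (pawalk_verts u p)) \<and> p \<noteq> []"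
    then obtain u where "set p \<subseteq> parcs G" "pcas u p u" "distinct (tl (pawalk_verts u p))" "p \<noteq> []"
      by blast
    then show "set p \<subseteq> parcs G" "\<exists>u. p \<noteq> [] \<and> pcas u p u \<and> distinct (map fst p)"
      using e by (auto simp: pcas_pawalk_verts)
  next
    assume "set p \<subseteq> parcs G \<and> (\<exists>u. p \<noteq> [] \<and> pcas u p u \<and> distinct (map fst p))"
    then obtain u where u: "set p \<subseteq> parcs G" "p \<noteq> []" "pcas u p u" "distinct (map fst p)"
      by blast
    then show "\<exists>u. (u \<in> pverts G \<and> set p \<subseteq> parcs G \<and> pcas u p u) \<and>
        distinct (tl (pawalk_verts u p)) \<and> p \<noteq> []"
      using e[OF u(3)] v[OF u(3,2,1)] by (intro exI[of _ u]) (simp add: pcas_pawalk_verts)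
  qed
qed

lemma closed_path_rotate:
  assumes "closed_path u p" "w \<in> fst ` set p"
  obtains q where "closed_path w q" "set q = set p" "length q = length p"
proof -
  from assms(2) obtain e where e: "e \<in> set p" "fst e = w" by blast
  then obtain p1 p2 where p: "p = p1 @ e # p2" by (meson split_list)
  show thesis
    by (rule that[of "e # p2 @ p1"]) (use assms(1) e in \<open>auto simp: closed_path_def p\<close>)
qed

text \<open>
  A set of vertices closed under the arcs of a cycle contains the whole cycle once it contains one
  of its vertices.
\<close>

lemma closed_path_induct_verts:
  assumes "closed_path u p" "u \<in> X" "\<And>v x. (v, x) \<in> set p \<Longrightarrow> v \<in> X \<Longrightarrow> x \<in> X"
  shows "fst ` set p \<subseteq> X"
proof -
  have "fst ` set q \<subseteq> X" if "pcas v q w" "v \<in> X" "set q \<subseteq> set p" for v q w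
    using that
  proof (induction q arbitrary: v)
    case (Cons e q)
    then have "snd e \<in> X" using assms(3)[of v "snd e"] by auto
    with Cons show ?case by auto
  qed simp
  then show ?thesis using assms(1,2) unfolding closed_path_def by blast
qed

lemma closed_path_unique_succ:
  assumes "closed_path u p" "(v, x) \<in> set p" "(v, y) \<in> set p"
  shows "x = y"
  using assms by (auto simp: closed_path_def distinct_map dest: inj_onD[of fst _ "(v, x)" "(v, y)"])

lemma closed_path_unique_pred:
  assumes "closed_path u p" "(v, x) \<in> set p" "(w, x) \<in> set p"
  shows "v = w"
proof -
  have "distinct (map snd p)"
    using assms(1) closed_path_mset[of u p] by (metis closed_path_def mset_eq_imp_distinct_iff)
  then show ?thesis
    using assms(2,3) by (auto simp: distinct_map dest: inj_onD[of snd _ "(v, x)" "(w, x)"])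
qed

lemma card_closed_path: "closed_path u p \<Longrightarrow> card (set p) = length p"
  by (auto simp: closed_path_def distinct_card distinct_map)

lemma closed_path_reaches:
  assumes "closed_path u p" "x \<in> fst ` set p" "y \<in> fst ` set p"
  shows "(x, y) \<in> (set p)\<^sup>*"
proof -
  obtain q where q: "closed_path x q" "set q = set p"
    using closed_path_rotate[OF assms(1,2)] by blast
  have "fst ` set q \<subseteq> {z. (x, z) \<in> (set p)\<^sup>*}"
    using q by (intro closed_path_induct_verts[OF q(1)]) (auto intro: rtrancl_into_rtrancl)
  then show ?thesis using q assms(3) by auto
qed

text \<open>
  If no arc of \<open>C\<close> left \<open>D\<close> at a vertex of \<open>D\<close>, then following \<open>C\<close> from a common vertex would stay in
  \<open>D\<close>, and both cycles would coincide.
\<close>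

lemma branch_vertex_exists:
  assumes C: "closed_path c C" and D: "closed_path d D" and "set C \<noteq> set D" "set C \<inter> set D \<noteq> {}"
  shows "\<exists>w p. (w, p) \<in> set C \<and> (w, p) \<notin> set D \<and> w \<in> fst ` set D"
proof (rule ccontr)
  assume "\<not> ?thesis"
  then have no: "(v, x) \<in> set D" if "(v, x) \<in> set C" "v \<in> fst ` set D" for v x
    using that by blast
  obtain u where u: "u \<in> fst ` set C" "u \<in> fst ` set D"
    using assms(4) by force
  obtain C' where C': "closed_path u C'" "set C' = set C"
    using closed_path_rotate[OF C u(1)] by blast
  obtain D' where D': "closed_path u D'" "set D' = set D"
    using closed_path_rotate[OF D u(2)] by blast
  have "fst ` set C' \<subseteq> fst ` set D"
    by (rule closed_path_induct_verts[OF C'(1) u(2)]) (use no C'(2) closed_path_head[OF D] in blast)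
  then have sub: "set C \<subseteq> set D"
    using no C'(2) by (metis image_subset_iff prod.collapse subsetI)
  have succ: "(v, x) \<in> set C" if vx: "(v, x) \<in> set D" "v \<in> fst ` set C" for v x
  proof -
    obtain y where "(v, y) \<in> set C" using vx(2) by auto
    then show ?thesis
      using closed_path_unique_succ[OF D vx(1), of y] sub by blast
  qed
  have "fst ` set D' \<subseteq> fst ` set C"
    by (rule closed_path_induct_verts[OF D'(1) u(1)]) (use succ D'(2) closed_path_head[OF C] in blast)
  then have "set D \<subseteq> set C"
    using succ D'(2) by (metis image_subset_iff prod.collapse subsetI)
  with sub \<open>set C \<noteq> set D\<close> show False by blast
qed

text \<open>
  Two cycles without further cycles in their union share one path, which ends at the only vertex
  \<open>w\<close> where \<open>C\<close> branches off from \<open>D\<close>.  Follow \<open>C\<close> from \<open>w\<close> until it first meets \<open>D\<close> again, and go back to \<open>w\<close> along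
  \<open>D\<close>.  This is a cycle using an arc outside \<open>D\<close>, so it must be \<open>C\<close>: after the
  first return \<open>C\<close> runs inside \<open>D\<close>.  Hence the \<open>m\<close> common arcs are exactly those of \<open>C\<close> after the
  return, and the length of \<open>C\<close> leaves at least three arcs for the excursion.  Its first
  two inner vertices \<open>p\<close> and \<open>p'\<close> are therefore not on \<open>D\<close>.
\<close>

lemma two_cycles_structure:
  assumes C: "closed_path c C" and D: "closed_path d D" and ne: "set C \<noteq> set D"
    and m: "card (set C \<inter> set D) = m" "m \<ge> 1"
    and only: "\<And>e E. closed_path e E \<Longrightarrow> set E \<subseteq> set C \<union> set D \<Longrightarrow> set E = set C \<or> set E = set D"
    and long: "length C > m + 2"
  obtains w p p' where "(w, p) \<in> set C" "w \<in> fst ` set D" "p \<notin> fst ` set D"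
    "(p, p') \<in> set C" "p' \<notin> fst ` set D"
    "\<And>v x. v \<in> fst ` set D \<Longrightarrow> (v, x) \<in> set C \<Longrightarrow> v \<noteq> w \<Longrightarrow> (v, x) \<in> set D"
proof -
  let ?V = "fst ` set D"
  have "set C \<inter> set D \<noteq> {}" using m by force
  then obtain w p0 where w: "(w, p0) \<in> set C" "(w, p0) \<notin> set D" "w \<in> ?V"
    using branch_vertex_exists[OF C D ne] by blast
  obtain C' where C': "closed_path w C'" "set C' = set C" "length C' = length C"
    using closed_path_rotate[OF C, of w] w by force
  have "last C' \<in> set C'" "snd (last C') \<in> ?V"
    using C'(1) pcas_last[of w C' w] w by (auto simp: closed_path_def)
  \<comment> \<open>\<open>e\<close> is the arc by which \<open>C\<close> first returns to \<open>D\<close>; \<open>?B\<close> is the excursion away from \<open>D\<close>.\<close>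
  then obtain Q e R where split: "C' = Q @ e # R" "snd e \<in> ?V" "\<forall>x\<in>set Q. snd x \<notin> ?V"
    using split_list_first_prop[of C' "\<lambda>x. snd x \<in> ?V"] by blast
  let ?B = "Q @ [e]"
  have B: "pcas w ?B (snd e)" "distinct (map fst (?B @ R))"
    using C'(1) by (auto simp: split closed_path_def)
  have tails: "map fst ?B = w # map snd Q"
    using pcas_heads[OF B(1)] by simp
  obtain f B' where f: "?B = f # B'" by (cases ?B) auto
  then have "fst f = w" using tails by simp
  then have "f = (w, p0)"
    using closed_path_unique_succ[OF C, of w p0 "snd f"] w C'(2) f split(1)
    by (metis Un_iff append_Cons append_assoc append_self_conv2 list.set_intros(1) prod.collapse)
  then have f_notin: "f \<notin> set D" using w by simp
  have B'_tails: "fst x \<notin> ?V" if "x \<in> set B'" for x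
  proof -
    have "map fst B' = map snd Q" using tails f by simp
    then have "fst ` set B' = snd ` set Q" by (metis list.set_map)
    then have "fst x \<in> snd ` set Q" using imageI[OF that, of fst] by simp
    then obtain z where "z \<in> set Q" "fst x = snd z" by (rule imageE)
    then show ?thesis using split(3) by simp
  qed
  obtain D' where D': "closed_path (snd e) D'" "set D' = set D"
    using closed_path_rotate[OF D split(2)] by blast
  \<comment> \<open>\<open>D1\<close> is the part of \<open>D\<close> that leads from the point of return back to \<open>w\<close>.\<close>
  obtain D1 g D2 where D1: "D' = D1 @ g # D2" "fst g = w"
    using w(3) D'(2) by (metis (no_types, lifting) imageE split_list)
  have D1': "pcas (snd e) D1 w" "distinct (map fst D1)" "w \<notin> fst ` set D1" "set D1 \<subseteq> set D"
    using D'(1) D1 D'(2)[symmetric] by (auto simp: closed_path_def)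
  have "closed_path w (?B @ D1)"
    unfolding closed_path_def
  proof (intro conjI)
    show "pcas w (?B @ D1) w" using B(1) D1'(1) by auto
    have "fst ` set ?B \<inter> fst ` set D1 = {}"
    proof -
      have "fst ` set ?B = insert w (fst ` set B')"
        using \<open>fst f = w\<close> unfolding f by simp
      moreover have "fst ` set B' \<inter> ?V = {}" using B'_tails by (metis disjoint_iff imageE)
      moreover have "fst ` set D1 \<subseteq> ?V" using D1'(4) by (rule image_mono)
      moreover have "X = insert w Y \<Longrightarrow> Y \<inter> V = {} \<Longrightarrow> Z \<subseteq> V \<Longrightarrow> w \<notin> Z \<Longrightarrow> X \<inter> Z = {}" for X Y Z V
        by blast
      ultimately show ?thesis using D1'(3) by metis
    qed
    then show "distinct (map fst (?B @ D1))"
      using B(2) D1'(2) unfolding map_append distinct_append by (auto simp del: append.simps)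
  qed simp
  moreover have "set (?B @ D1) \<subseteq> set C \<union> set D"
    using C'(2) D1'(4) by (auto simp: split)
  moreover have "set (?B @ D1) \<noteq> set D"
    using f_notin unfolding f by auto
  ultimately have E: "set (?B @ D1) = set C"
    using only by blast
  have R: "set R \<subseteq> set D"
  proof
    fix x assume x: "x \<in> set R"
    then have "x \<notin> set ?B"
      using B(2) by (auto dest: inj_onD simp: distinct_map)
    moreover have "x \<in> set C" using x C'(2) split(1) by auto
    ultimately show "x \<in> set D" using E D1'(4) by auto
  qed
  have B_notin: "x \<notin> set D" if "x \<in> set ?B" for x
    using that f_notin B'_tails[of x] unfolding f by auto
  have "set C \<inter> set D = set R"
    using C'(2) split(1) R B_notin by auto
  then have "m = length R"
    using m(1) B(2) by (metis distinct_append distinct_card distinct_map map_append)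
  then have "length Q \<ge> 2"
    using long C'(3) split(1) by simp
  then obtain x1 x2 Q' where Q: "Q = x1 # x2 # Q'"
    by (metis Suc_le_length_iff numeral_2_eq_2)
  then have x: "fst x1 = w" "fst x2 = snd x1" using B(1) by auto
  show thesis
  proof (rule that)
    have "x1 \<in> set C" "x2 \<in> set C"
      by (simp_all add: C'(2)[symmetric] split(1) Q)
    then show "(w, snd x1) \<in> set C" "(snd x1, snd x2) \<in> set C"
      using x by (metis prod.collapse)+
    show "snd x1 \<notin> ?V" "snd x2 \<notin> ?V" using split(3) Q by auto
    fix v y assume v: "v \<in> ?V" "(v, y) \<in> set C" "v \<noteq> w"
    then have "(v, y) \<notin> set ?B"
      using B'_tails[of "(v, y)"] \<open>fst f = w\<close> unfolding f by auto
    then show "(v, y) \<in> set D" using v(2) C'(2) split(1) R by auto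
  qed fact
qed


section \<open>Two cycles and their complete realisation\<close>

definition sign_coeff :: "'n rel \<Rightarrow> 'n \<Rightarrow> 'n \<Rightarrow> real" where
  "sign_coeff A j i = (if i = j then 0 else if (j, i) \<in> A then 1 else - 1)"

lemma simplex_coefficients_sign_coeff:
  "simplex_coefficients \<lparr>pverts = V, parcs = A\<rparr> (sign_coeff A)"
  by (auto simp: simplex_coefficients_def sign_coeff_def)

lemma ranked_tournament_sign_coeff:
  assumes "asymp_on K (\<lambda>u v. (u, v) \<in> A)" "inj_on r K"
    and "\<And>l i. l \<in> K \<Longrightarrow> i \<in> K \<Longrightarrow> r l < r i \<Longrightarrow> (l, i) \<in> A"
  shows "ranked_tournament (sign_coeff A) K r"
  using assms by (auto simp: ranked_tournament_def sign_coeff_def asymp_on_def)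

lemma no_1_2_cycles_of_asym:
  assumes "pair_wf_digraph G" and asym: "\<And>u v. (u, v) \<in> parcs G \<Longrightarrow> (v, u) \<notin> parcs G"
  shows "no_1_2_cycles G"
  unfolding no_1_2_cycles_def cycle_iff_closed_path[OF assms(1)]
proof (intro allI impI)
  fix E assume "set E \<subseteq> parcs G \<and> (\<exists>u. closed_path u E)"
  then obtain u where E: "set E \<subseteq> parcs G" "closed_path u E" by blast
  then obtain e E' where e: "E = e # E'" by (cases E) (auto simp: closed_path_def)
  show "length E \<noteq> 1 \<and> length E \<noteq> 2"
  proof (cases E')
    case Nil
    with E e asym[of "fst e" "snd e"] show ?thesis by (cases e) (auto simp: closed_path_def)
  next
    case (Cons f E'')
    with E e asym[of "fst e" "snd e"] show ?thesis
      by (cases e; cases f; cases E'') (auto simp: closed_path_def)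
  qed
qed

text \<open>
  Let \<open>w\<close> be the branch vertex, \<open>p\<close> and \<open>p'\<close> the next two vertices of \<open>C\<close>, and add arcs to \<open>p\<close>
  from all vertices of \<open>D\<close>.  A vertex of \<open>D\<close> then has as out-neighbours its successor in \<open>D\<close> and
  \<open>p\<close>, joined by an arc into \<open>p\<close>; a vertex outside \<open>D\<close> has its successor in \<open>C\<close> only.  In both cases
  a vertex and its out-neighbours form a transitive tournament, so the completeness
  criterion applies.  No 2-cycle arises, because the only arc leaving \<open>p\<close> goes to \<open>p'\<close>, which is
  not on \<open>D\<close>.

  The vertices of \<open>C\<close> outside \<open>D\<close> have gained no outgoing arc, and each common vertex has exactly one
  that is not in \<open>C\<close>: its new arc to \<open>p\<close>, except at \<open>w\<close>, whose arc to \<open>p\<close> is in \<open>C\<close>, so that the arc of \<open>D\<close>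
  plays this role there.
\<close>

lemma two_cycle_realisation:
  fixes G :: "'n::finite pair_pre_digraph" and C D :: "('n \<times> 'n) list"
  assumes G: "pair_fin_digraph G" "pverts G = UNIV"
    and two: "consists_of_two_cycles G C D"
    and m: "card (set C \<inter> set D) = m" "m \<ge> 1"
    and long: "length C > m + 2" "length D > m + 2"
  shows "\<exists>G' a. complete_realisation G G' a \<and>
     card (positive_transverse a C) = m + 1 \<and>
     (\<forall>j \<in> cycle_verts C \<inter> cycle_verts D. \<exists>!i. (j, i) \<in> positive_transverse a C) \<and>
     (\<forall>(j, i) \<in> positive_transverse a C. j \<in> cycle_verts C \<inter> cycle_verts D)"
proof -
  interpret pair_fin_digraph G by (rule G)
  have wf: "pair_wf_digraph G" by unfold_locales
  note cyc = cycle_iff_closed_path[OF wf]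
  let ?VC = "fst ` set C" and ?VD = "fst ` set D"
  have arcs: "parcs G = set C \<union> set D" and ne: "set C \<noteq> set D"
    using two by (auto simp: consists_of_two_cycles_def)
  have verts: "v \<in> ?VC \<or> v \<in> ?VD" for v
    using two G(2) unfolding consists_of_two_cycles_def cycle_verts_def by (metis UNIV_I Un_iff)
  have only: "set E = set C \<or> set E = set D" if "closed_path e E" "set E \<subseteq> set C \<union> set D" for e E
    using two that unfolding consists_of_two_cycles_def cyc arcs by blast
  obtain c d0 where C: "closed_path c C" and D: "closed_path d0 D"
    using two unfolding consists_of_two_cycles_def cyc by blast
  obtain w p p' where wp: "(w, p) \<in> set C" "w \<in> ?VD" "p \<notin> ?VD" "(p, p') \<in> set C" "p' \<notin> ?VD"
    and shared: "\<And>v x. v \<in> ?VD \<Longrightarrow> (v, x) \<in> set C \<Longrightarrow> v \<noteq> w \<Longrightarrow> (v, x) \<in> set D"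
    by (rule two_cycles_structure[OF C D ne m _ long(1)]) (use only in blast)+
  obtain d where d: "(w, d) \<in> set D" using wp(2) by auto
  have wVC: "w \<in> ?VC" using wp(1) by force

  have short: "card (set E) > 2" if "closed_path e E" "set E \<subseteq> parcs G" for e E
    using only[of e E] that card_closed_path[OF C] card_closed_path[OF D] long arcs by auto
  \<comment> \<open>A loop or a pair of opposite arcs of \<open>G\<close> would be a third cycle, too short for \<open>C\<close> or \<open>D\<close>.\<close>
  have G_asym: "(v, u) \<notin> parcs G" if "(u, v) \<in> parcs G" for u v
  proof
    assume "(v, u) \<in> parcs G"
    moreover have "closed_path u (if u = v then [(u, u)] else [(u, v), (v, u)])"
      by (auto simp: closed_path_def)
    ultimately show False
      using short[of u "if u = v then [(u, u)] else [(u, v), (v, u)]"] that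
      by (auto split: if_splits simp: card_insert_if)
  qed

  define A where "A = parcs G \<union> ?VD \<times> {p}"
  define G' where "G' = \<lparr>pverts = UNIV, parcs = A\<rparr>"
  define a where "a = sign_coeff A"
  have A_asym: "(v, u) \<notin> A" if "(u, v) \<in> A" for u v
  proof -
    have new: "(p, u) \<notin> A" if "u \<in> ?VD" for u
    proof
      assume "(p, u) \<in> A"
      then have "(p, u) \<in> set C" using wp(3) by (auto simp: A_def arcs image_iff)
      then have "u = p'" using closed_path_unique_succ[OF C _ wp(4)] by blast
      then show False using that wp(5) by simp
    qed
    show ?thesis
    proof
      assume vu: "(v, u) \<in> A"
      show False
      proof (cases "(u, v) \<in> parcs G \<and> (v, u) \<in> parcs G")
        case True then show ?thesis using G_asym by blast
      next
        case False
        then have "u \<in> ?VD \<and> v = p \<or> v \<in> ?VD \<and> u = p"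
          using that vu unfolding A_def by blast
        then show ?thesis using new that vu by blast
      qed
    qed
  qed
  have A_irrefl: "(u, u) \<notin> A" for u using A_asym by blast
  have wf': "pair_wf_digraph G'" by unfold_locales (auto simp: G'_def)

  have succ_in_D: "A `` {v} = {x, p}" if "(v, x) \<in> set D" for v x
  proof -
    have v: "v \<in> ?VD" using that by force
    have "y = x \<or> y = p" if "(v, y) \<in> set C" for y
      using shared[OF v that] closed_path_unique_succ[OF D \<open>(v, x) \<in> set D\<close>, of y]
        closed_path_unique_succ[OF C wp(1), of y] that by blast
    then show ?thesis
      using closed_path_unique_succ[OF D that] that v unfolding A_def arcs by blast
  qed
  have succ_outside_D: "A `` {v} = {x}" if "(v, x) \<in> set C" "v \<notin> ?VD" for v x
  proof -
    have "(v, y) \<notin> set D" for y using that(2) by (metis fst_conv image_eqI)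
    then show ?thesis
      using closed_path_unique_succ[OF C that(1)] that unfolding A_def arcs by blast
  qed

  \<comment> \<open>The order of the tournament at a vertex of \<open>D\<close>: the vertex, its successor in \<open>D\<close>, then \<open>p\<close>.\<close>
  define r where "r j i = (if i = j then 0 else if j \<in> ?VD \<and> i = p then 2 else 1 :: nat)" for j i
  have rank: "ranked_tournament a (insert j (parcs G' `` {j})) (r j)" for j
  proof -
    have K: "parcs G' = A" by (simp add: G'_def)
    show ?thesis
      unfolding a_def K
    proof (rule ranked_tournament_sign_coeff)
      show "asymp_on (insert j (A `` {j})) (\<lambda>u v. (u, v) \<in> A)"
        using A_asym by (auto simp: asymp_on_def)
      consider x where "(j, x) \<in> set D" | x where "(j, x) \<in> set C" "j \<notin> ?VD"
        using verts[of j] by (cases "j \<in> ?VD") auto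
      then have "inj_on (r j) (insert j (A `` {j})) \<and>
         (\<forall>l\<in>insert j (A `` {j}). \<forall>i\<in>insert j (A `` {j}). r j l < r j i \<longrightarrow> (l, i) \<in> A)"
      proof cases
        case (1 x)
        have VD: "j \<in> ?VD" "x \<in> ?VD" using 1 closed_path_head[OF D] by force+
        then have "(j, x) \<in> A" "(j, p) \<in> A" "(x, p) \<in> A"
          using 1 by (auto simp: A_def arcs)
        moreover from this have "j \<noteq> x" "j \<noteq> p" "x \<noteq> p" using A_irrefl by auto
        ultimately show ?thesis
          unfolding succ_in_D[OF 1] using VD(1) by (auto simp: r_def)
      next
        case (2 x)
        then have "(j, x) \<in> A" by (auto simp: A_def arcs)
        moreover from this have "j \<noteq> x" using A_irrefl by auto
        ultimately show ?thesis
          unfolding succ_outside_D[OF 2] using 2(2) by (auto simp: r_def)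
      qed
      then show "inj_on (r j) (insert j (A `` {j}))"
        and "\<And>l i. l \<in> insert j (A `` {j}) \<Longrightarrow> i \<in> insert j (A `` {j}) \<Longrightarrow> r j l < r j i \<Longrightarrow> (l, i) \<in> A"
        by blast+
    qed
  qed
  have complete: "complete_realisation G G' a"
    unfolding complete_realisation_def
  proof (intro conjI)
    show "strongly_connected (with_proj G)"
    proof -
      have mono: "(set C)\<^sup>* \<subseteq> (parcs G)\<^sup>*" "(set D)\<^sup>* \<subseteq> (parcs G)\<^sup>*"
        unfolding arcs by (auto intro!: rtrancl_mono)
      have "(u, w) \<in> (parcs G)\<^sup>*" "(w, u) \<in> (parcs G)\<^sup>*" for u
        using closed_path_reaches[OF C _ wVC, of u] closed_path_reaches[OF C wVC, of u]
          closed_path_reaches[OF D _ wp(2), of u] closed_path_reaches[OF D wp(2), of u]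
          verts[of u] mono by blast+
      then show ?thesis
        unfolding strongly_connected_def by (auto simp: G(2) reachable_conv intro: rtrancl_trans)
    qed
    show "no_1_2_cycles G" by (rule no_1_2_cycles_of_asym[OF wf G_asym])
    show "no_1_2_cycles G'" by (rule no_1_2_cycles_of_asym[OF wf']) (use A_asym in \<open>simp add: G'_def\<close>)
    show "spanning (with_proj G) (with_proj G')"
      using wf wf' unfolding spanning_def subgraph_def wf_digraph_wp_iff
      by (auto simp: compatible_def G'_def G(2) A_def)
    show "simplex_coefficients G' a"
      unfolding G'_def a_def by (rule simplex_coefficients_sign_coeff)
    then show "complete_network G' a"
      by (rule complete_network_of_ranked_out_neighbours[OF _ rank])
    show "\<forall>(j, i)\<in>parcs G'. planar_connection a j i"
    proof (intro ballI, clarify)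
      fix j i assume "(j, i) \<in> parcs G'"
      then have "(j, i) \<in> A" "j \<noteq> i" using A_irrefl by (auto simp: G'_def)
      then show "planar_connection a j i"
        using A_asym[of j i] by (intro planar_connection_of_arc) (auto simp: a_def sign_coeff_def)
    qed
  qed (rule G)

  \<comment> \<open>As \<open>A\<close> has no opposite arcs, none of its arcs points in a contracting direction of \<open>C\<close>.\<close>
  have pt: "positive_transverse a C = {(j, i). (j, i) \<in> A \<and> j \<in> ?VC \<and> (j, i) \<notin> set C}"
  proof -
    have ev: "(\<exists>c>0. eigenvalue_in_direction (simplex_field a) (equil j) i c) \<longleftrightarrow> (j, i) \<in> A" if "i \<noteq> j" for j i
      using that by (subst eigenvalue_in_direction_simplex_field) (auto simp: a_def sign_coeff_def)
    have "(i, j) \<notin> set C" if "(j, i) \<in> A" for i j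
      using A_asym[OF that] by (auto simp: A_def arcs)
    then have "(j \<in> ?VC \<and> i \<noteq> j \<and> (i, j) \<notin> set C \<and> (j, i) \<notin> set C \<and>
        (\<exists>c>0. eigenvalue_in_direction (simplex_field a) (equil j) i c)) \<longleftrightarrow>
        (j, i) \<in> A \<and> j \<in> ?VC \<and> (j, i) \<notin> set C" for j i
      using ev[of i j] A_irrefl[of j] by (cases "i = j") (simp, metis)
    then show ?thesis
      unfolding positive_transverse_def cycle_verts_def by (simp only:)
  qed
  define t where "t j = (if j = w then d else p)" for j
  have pt_eq: "positive_transverse a C = (\<lambda>j. (j, t j)) ` (?VC \<inter> ?VD)"
  proof (intro equalityI subsetI)
    fix e assume "e \<in> positive_transverse a C"
    then obtain j i where e: "e = (j, i)" and ji: "(j, i) \<in> A" "j \<in> ?VC" "(j, i) \<notin> set C"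
      unfolding pt by blast
    have VD: "j \<in> ?VD" using ji by (force simp: A_def arcs)
    moreover have "i = t j"
    proof -
      obtain x where x: "(j, x) \<in> set D" using VD by auto
      obtain y where y: "(j, y) \<in> set C" using ji(2) by auto
      have "i = x \<or> i = p" using succ_in_D[OF x] ji(1) by blast
      moreover have "x = y" if "j \<noteq> w"
        using closed_path_unique_succ[OF D x shared[OF VD y that]] .
      moreover have "x = d" if "j = w" using closed_path_unique_succ[OF D d] x that by blast
      ultimately show ?thesis using ji(3) y wp(1) by (auto simp: t_def)
    qed
    ultimately show "e \<in> (\<lambda>j. (j, t j)) ` (?VC \<inter> ?VD)" using e ji(2) by auto
  next
    fix e assume "e \<in> (\<lambda>j. (j, t j)) ` (?VC \<inter> ?VD)"
    then obtain j where e: "e = (j, t j)" and j: "j \<in> ?VC" "j \<in> ?VD" by blast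
    have "(j, t j) \<in> A" using j d by (auto simp: t_def A_def arcs)
    moreover have "(j, t j) \<notin> set C"
    proof
      assume in_C: "(j, t j) \<in> set C"
      have "j = w"
      proof (rule ccontr)
        assume "j \<noteq> w"
        then show False using closed_path_unique_pred[OF C wp(1), of j] in_C by (simp add: t_def)
      qed
      then have "d = p"
        using in_C closed_path_unique_succ[OF C wp(1), of d] by (simp add: t_def)
      then show False using wp(3) closed_path_head[OF D d] by simp
    qed
    ultimately show "e \<in> positive_transverse a C" using e j(1) unfolding pt by blast
  qed

  have "?VC \<inter> ?VD = insert w (fst ` (set C \<inter> set D))"
  proof (intro equalityI subsetI)
    fix v assume v: "v \<in> ?VC \<inter> ?VD"
    then obtain x where "(v, x) \<in> set C" by auto
    then show "v \<in> insert w (fst ` (set C \<inter> set D))"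
      using shared[of v x] v by (cases "v = w") force+
  qed (use wVC wp(2) in auto)
  moreover have "w \<notin> fst ` (set C \<inter> set D)"
    using closed_path_unique_succ[OF C wp(1)] closed_path_head[OF D] wp(3) by auto
  moreover have "card (fst ` (set C \<inter> set D)) = m"
    using C m(1) by (subst card_image) (auto simp: closed_path_def distinct_map intro: inj_on_subset)
  ultimately have "card (?VC \<inter> ?VD) = m + 1" by simp
  then have "card (positive_transverse a C) = m + 1"
    unfolding pt_eq by (subst card_image) (auto intro: inj_onI)
  moreover have "\<forall>j \<in> cycle_verts C \<inter> cycle_verts D. \<exists>!i. (j, i) \<in> positive_transverse a C"
    "\<forall>(j, i) \<in> positive_transverse a C. j \<in> cycle_verts C \<inter> cycle_verts D"
    unfolding pt_eq cycle_verts_def by auto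
  ultimately show ?thesis using complete by blast
qed

lemma consists_of_two_cycles_sym:
  "consists_of_two_cycles G C D \<Longrightarrow> consists_of_two_cycles G D C"
  unfolding consists_of_two_cycles_def by blast

theorem proposition4p4:
  fixes G :: "'n::finite pair_pre_digraph" and C1 C2 :: "('n \<times> 'n) list" and m :: nat
  assumes "pair_fin_digraph G" and "pverts G = UNIV"
    and "consists_of_two_cycles G C1 C2"
    and "card (set C1 \<inter> set C2) = m" and "m \<ge> 1"
    and "min (length C1) (length C2) > m + 2"
  shows "\<forall>C\<in>{C1, C2}. \<exists>(G' :: 'n pair_pre_digraph) a.
           complete_realisation G G' a \<and>
           card (positive_transverse a C) = m + 1 \<and>
           (\<forall>j \<in> cycle_verts C1 \<inter> cycle_verts C2. \<exists>!i. (j, i) \<in> positive_transverse a C) \<and>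
           (\<forall>(j, i) \<in> positive_transverse a C. j \<in> cycle_verts C1 \<inter> cycle_verts C2)"
proof -
  have "length C1 > m + 2" "length C2 > m + 2" using assms(6) by auto
  then show ?thesis
    using two_cycle_realisation[OF assms(1-5)]
      two_cycle_realisation[OF assms(1,2) consists_of_two_cycles_sym[OF assms(3)] _ assms(5)] assms(4)
    by (auto simp: Int_commute)
qed

end
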